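(* Let $Y,Y_1,Y_2,\ldots$ be i.i.d. real random variables with $\mathbb{E}e^{Y}=1$, and let $\{W_n\}$ be the CUSUM process generated by $Y_1,Y_2,\ldots$. For any sample size $n$ and any threshold $h$, $$\mathbb{P}\Bigl\{\max_{0\le t\le n}W_t\ge h\Bigr\}\le \min\Bigl\{e^{-h}\bigl(1+n\,\mathbb{E}(1-e^{Y})^+\bigr),\,1\Bigr\},$$ and the exponential moment of the CUSUM process satisfies $$\mathbb{E}e^{W_n}\le 1+n\,\mathbb{E}(1-e^{Y})^+ .$$
   Context: The CUSUM process based on $Y_1,Y_2,\ldots$ is defined by $W_0=0$ and $W_{n+1}=\max\{W_n+Y_{n+1},0\}$. Notation: $x^+=\max\{x,0\}$. *)

theory Defs
  imports "HOL-Probability.Probability"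
begin

(* The observations are Y 1, Y 2, ...; the value Y 0 is never used. *)
primrec cusum :: "(nat \<Rightarrow> 'a \<Rightarrow> real) \<Rightarrow> nat \<Rightarrow> 'a \<Rightarrow> real" where
  "cusum Y 0 \<omega> = 0"
| "cusum Y (Suc n) \<omega> = max (cusum Y n \<omega> + Y (Suc n) \<omega>) 0"

end

theory Submission
  imports Defs
begin

text \<open>
  Since \<open>W\<^sub>n \<ge> 0\<close>, one step of the recursion gives
  \<open>exp W\<^bsub>n+1\<^esub> = exp W\<^sub>n * exp Y\<^bsub>n+1\<^esub> + (1 - exp (W\<^sub>n + Y\<^bsub>n+1\<^esub>))\<^sup>+ \<le> exp W\<^sub>n * exp Y\<^bsub>n+1\<^esub> + (1 - exp Y\<^bsub>n+1\<^esub>)\<^sup>+\<close>,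
  so by independence and \<open>E (exp Y) = 1\<close> the exponential moment grows by at most
  \<open>E (1 - exp Y)\<^sup>+\<close> per step. The same holds for the process frozen on first entering a
  Borel set. Freezing on \<open>{h..}\<close> turns the maximum into the final value, so the Markov inequality
  replaces the maximal inequality for submartingales.
\<close>

text \<open>Freezing is decided by the current value alone, so the recursion needs no explicit
  stopping time. The set is a parameter because the empty set never freezes, which lets one moment
  bound cover both claims.\<close>

primrec stopped_cusum :: "real set \<Rightarrow> (nat \<Rightarrow> 'a \<Rightarrow> real) \<Rightarrow> nat \<Rightarrow> 'a \<Rightarrow> real" where
  "stopped_cusum A Y 0 \<omega> = 0"
| "stopped_cusum A Y (Suc n) \<omega> =
    (if stopped_cusum A Y n \<omega> \<in> A then stopped_cusum A Y n \<omega>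
     else max (stopped_cusum A Y n \<omega> + Y (Suc n) \<omega>) 0)"

lemma stopped_cusum_nonneg: "stopped_cusum A Y n \<omega> \<ge> 0"
  by (induction n) auto

lemma stopped_cusum_empty: "stopped_cusum {} Y n \<omega> = cusum Y n \<omega>"
  by (induction n) auto

lemma stopped_cusum_hits_iff:
  "stopped_cusum A Y n \<omega> \<in> A \<longleftrightarrow> (\<exists>t\<le>n. cusum Y t \<omega> \<in> A)"
proof -
  \<comment> \<open>The induction also has to know that both processes agree as long as
    \<open>A\<close> has not been visited; otherwise a first visit of one says nothing about the
    other.\<close>
  have "(if \<exists>t\<le>n. cusum Y t \<omega> \<in> A then stopped_cusum A Y n \<omega> \<in> A
         else stopped_cusum A Y n \<omega> = cusum Y n \<omega>)"
  proof (induction n)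
    case (Suc n)
    then show ?case
      by (auto simp: le_Suc_eq split: if_splits)
  qed auto
  then show ?thesis
    by (auto split: if_splits)
qed

text \<open>Two sample points in possibly different spaces are allowed, so that the process can be
  compared with the same recursion run on a product space.\<close>

lemma stopped_cusum_cong:
  assumes "\<And>i. i \<in> {1..n} \<Longrightarrow> Y i \<omega> = Z i \<eta>"
  shows "stopped_cusum A Y n \<omega> = stopped_cusum A Z n \<eta>"
  using assms by (induction n) auto

lemma borel_measurable_stopped_cusum:
  assumes [measurable]: "A \<in> sets borel"
    and "\<And>i. i \<in> {1..n} \<Longrightarrow> Y i \<in> borel_measurable M"
  shows "stopped_cusum A Y n \<in> borel_measurable M"
  using assms(2)
proof (induction n)
  case 0
  have "stopped_cusum A Y 0 = (\<lambda>\<omega>. 0)" by auto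
  then show ?case by simp
next
  case (Suc n)
  then have [measurable]: "stopped_cusum A Y n \<in> borel_measurable M"
    "Y (Suc n) \<in> borel_measurable M" by auto
  have "stopped_cusum A Y (Suc n) = (\<lambda>\<omega>. if stopped_cusum A Y n \<omega> \<in> A
      then stopped_cusum A Y n \<omega> else max (stopped_cusum A Y n \<omega> + Y (Suc n) \<omega>) 0)"
    by auto
  then show ?case by simp
qed

context prob_space
begin

lemma indep_var_stopped_cusum:
  assumes ind: "indep_vars (\<lambda>_. borel) Y {1..}" and A: "A \<in> sets borel"
  shows "indep_var borel (stopped_cusum A Y n) borel (Y (Suc n))"
proof -
  \<comment> \<open>With coordinate projections as observations, the recursion becomes a measurable
    functional of the first \<open>n\<close> coordinates. Independence of disjoint blocks of
    observations then passes to the process and the next observation.\<close>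
  let ?V = "stopped_cusum A (\<lambda>i f. f i) n"
  have "indep_var (PiM {1..n} (\<lambda>_. borel)) (\<lambda>\<omega>. restrict (\<lambda>i. Y i \<omega>) {1..n})
     (PiM {Suc n} (\<lambda>_. borel)) (\<lambda>\<omega>. restrict (\<lambda>i. Y i \<omega>) {Suc n})"
    by (rule indep_var_restrict[OF ind]) auto
  moreover have "?V \<in> borel_measurable (PiM {1..n} (\<lambda>_. borel))"
    using A by (rule borel_measurable_stopped_cusum) (rule measurable_component_singleton)
  moreover have "(\<lambda>f. f (Suc n)) \<in> borel_measurable (PiM {Suc n} (\<lambda>_. borel :: real measure))"
    by (rule measurable_component_singleton) simp
  ultimately have "indep_var borel (?V \<circ> (\<lambda>\<omega>. restrict (\<lambda>i. Y i \<omega>) {1..n}))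
     borel ((\<lambda>f. f (Suc n)) \<circ> (\<lambda>\<omega>. restrict (\<lambda>i. Y i \<omega>) {Suc n}))"
    by (rule indep_var_compose)
  moreover have "?V \<circ> (\<lambda>\<omega>. restrict (\<lambda>i. Y i \<omega>) {1..n}) = stopped_cusum A Y n"
    by (auto simp: fun_eq_iff intro!: stopped_cusum_cong)
  ultimately show ?thesis
    by (simp add: comp_def)
qed

text \<open>Split \<open>exp X\<close> into \<open>F\<close> on \<open>A\<close> and
  \<open>G\<close> off \<open>A\<close>. Only \<open>G\<close> gets multiplied by
  \<open>exp Z\<close>, a factor of mean 1 independent of it, so the mean grows by no more than that
  of the correction \<open>K\<close>.\<close>

lemma exp_moment_step:
  fixes X Z :: "'a \<Rightarrow> real"
  assumes ind: "indep_var borel X borel Z" and A[measurable]: "A \<in> sets borel"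
    and nonneg: "\<And>\<omega>. X \<omega> \<ge> 0"
    and X: "integrable M (\<lambda>\<omega>. exp (X \<omega>))"
    and Z: "integrable M (\<lambda>\<omega>. exp (Z \<omega>))" "expectation (\<lambda>\<omega>. exp (Z \<omega>)) = 1"
  defines "S \<equiv> \<lambda>\<omega>. exp (if X \<omega> \<in> A then X \<omega> else max (X \<omega> + Z \<omega>) 0)"
  shows "integrable M S"
    and "expectation S \<le> expectation (\<lambda>\<omega>. exp (X \<omega>)) + expectation (\<lambda>\<omega>. max (1 - exp (Z \<omega>)) 0)"
proof -
  have [measurable]: "random_variable borel X" "random_variable borel Z"
    using ind indep_var_rv1 indep_var_rv2 by blast+
  define F where "F = (\<lambda>\<omega>. exp (X \<omega>) * indicator A (X \<omega>))"
  define G where "G = (\<lambda>\<omega>. exp (X \<omega>) * indicator (- A) (X \<omega>))"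
  define K where "K = (\<lambda>\<omega>. max (1 - exp (Z \<omega>)) 0)"
  have F: "integrable M F"
    unfolding F_def by (rule Bochner_Integration.integrable_bound[OF X]) (auto split: split_indicator)
  have G: "integrable M G"
    unfolding G_def by (rule Bochner_Integration.integrable_bound[OF X]) (auto split: split_indicator)
  have K: "integrable M K"
    unfolding K_def by (rule Bochner_Integration.integrable_bound[of _ "\<lambda>_. 1::real"]) auto
  have "indep_var borel ((\<lambda>x. exp x * indicator (- A) x) \<circ> X) borel (exp \<circ> Z)"
    by (rule indep_var_compose[OF ind]) auto
  then have GZ: "indep_var borel G borel (\<lambda>\<omega>. exp (Z \<omega>))"
    by (simp add: comp_def G_def)
  note GZ_int = indep_var_integrable[OF GZ G Z(1)]
  have S_le: "S \<omega> \<le> F \<omega> + G \<omega> * exp (Z \<omega>) + K \<omega>" for \<omega>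
  proof (cases "X \<omega> \<in> A")
    case False
    \<comment> \<open>This is the case where the maximum is 0: since \<open>X\<close> is
      nonnegative, the product is at least \<open>exp Z\<close>, and the positive part makes up the
      remaining \<open>1 - exp Z\<close>.\<close>
    have "1 \<le> exp (X \<omega>) * exp (Z \<omega>) + max (1 - exp (Z \<omega>)) 0"
      using mult_right_mono[of 1 "exp (X \<omega>)" "exp (Z \<omega>)"] nonneg[of \<omega>]
        max.cobounded1[of "1 - exp (Z \<omega>)" 0]
      by (smt (verit) exp_ge_zero one_le_exp_iff mult_1)
    then show ?thesis
      using False by (auto simp: S_def F_def G_def K_def exp_add max_def)
  qed (auto simp: S_def F_def G_def K_def)
  have bound: "integrable M (\<lambda>\<omega>. F \<omega> + G \<omega> * exp (Z \<omega>) + K \<omega>)"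
    using F GZ_int K by auto
  show S: "integrable M S"
  proof (rule Bochner_Integration.integrable_bound[OF bound])
    show "S \<in> borel_measurable M" unfolding S_def by measurable
    have "0 \<le> S \<omega>" for \<omega> by (simp add: S_def)
    then show "AE \<omega> in M. norm (S \<omega>) \<le> norm (F \<omega> + G \<omega> * exp (Z \<omega>) + K \<omega>)"
      using S_le by (intro always_eventually allI) (smt (verit) real_norm_def)
  qed
  have "expectation S \<le> expectation (\<lambda>\<omega>. F \<omega> + G \<omega> * exp (Z \<omega>) + K \<omega>)"
    by (rule integral_mono[OF S bound S_le])
  \<comment> \<open>By independence, the mean of \<open>G * exp Z\<close> is the mean of
    \<open>G\<close> times 1.\<close>
  also have "\<dots> = expectation F + expectation G + expectation K"
    using F GZ_int K indep_var_lebesgue_integral[OF GZ G Z(1)] Z(2) by simp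
  also have "expectation F + expectation G = expectation (\<lambda>\<omega>. F \<omega> + G \<omega>)"
    using F G by simp
  also have "(\<lambda>\<omega>. F \<omega> + G \<omega>) = (\<lambda>\<omega>. exp (X \<omega>))"
    by (auto simp: F_def G_def split: split_indicator)
  finally show "expectation S \<le> expectation (\<lambda>\<omega>. exp (X \<omega>)) + expectation (\<lambda>\<omega>. max (1 - exp (Z \<omega>)) 0)"
    by (simp add: K_def)
qed

text \<open>Integrability is carried through the induction together with the bound, because each
  one-step estimate presupposes it for the current value.\<close>

lemma stopped_cusum_exp_moment:
  fixes Y :: "'a \<Rightarrow> real"
  assumes Y: "Y \<in> borel_measurable M"
    and ind: "indep_vars (\<lambda>_. borel) Ys {1..}"
    and distr: "\<And>i. i \<ge> 1 \<Longrightarrow> distr M borel (Ys i) = distr M borel Y"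
    and Y_int: "integrable M (\<lambda>\<omega>. exp (Y \<omega>))" "expectation (\<lambda>\<omega>. exp (Y \<omega>)) = 1"
    and A: "A \<in> sets borel"
  shows "integrable M (\<lambda>\<omega>. exp (stopped_cusum A Ys n \<omega>)) \<and>
    expectation (\<lambda>\<omega>. exp (stopped_cusum A Ys n \<omega>))
      \<le> 1 + real n * expectation (\<lambda>\<omega>. max (1 - exp (Y \<omega>)) 0)"
proof (induction n)
  case 0
  then show ?case by (simp add: prob_space)
next
  case (Suc n)
  have Z: "Ys (Suc n) \<in> borel_measurable M"
    using ind by (auto simp: indep_vars_def)
  have d: "distr M borel (Ys (Suc n)) = distr M borel Y"
    by (rule distr) simp
  have int_eq: "expectation (\<lambda>\<omega>. g (Ys (Suc n) \<omega>)) = expectation (\<lambda>\<omega>. g (Y \<omega>))"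
    if "g \<in> borel_measurable borel" for g :: "real \<Rightarrow> real"
    using that Z Y d by (metis integral_distr)
  have "integrable M (\<lambda>\<omega>. exp (Ys (Suc n) \<omega>))"
    using integrable_distr_eq[OF Z, of exp] integrable_distr_eq[OF Y, of exp] d Y_int(1) by simp
  moreover have "expectation (\<lambda>\<omega>. exp (Ys (Suc n) \<omega>)) = 1"
    using int_eq[of exp] Y_int(2) by simp
  moreover have "expectation (\<lambda>\<omega>. max (1 - exp (Ys (Suc n) \<omega>)) 0)
      = expectation (\<lambda>\<omega>. max (1 - exp (Y \<omega>)) 0)"
    by (rule int_eq) simp
  ultimately show ?case
    using exp_moment_step[OF indep_var_stopped_cusum[OF ind A, of n] A stopped_cusum_nonneg] Suc
    by (simp add: algebra_simps)
qed

end

theorem theorem4p1: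
  fixes M :: "'a measure"
    and Y :: "'a \<Rightarrow> real"
    and Ys :: "nat \<Rightarrow> 'a \<Rightarrow> real"
    and n :: nat
    and h :: real
  assumes "prob_space M"
    and "Y \<in> borel_measurable M"
    and "prob_space.indep_vars M (\<lambda>_. borel) Ys {1..}"
    and "\<And>i. i \<ge> 1 \<Longrightarrow> distr M borel (Ys i) = distr M borel Y"
    and "integrable M (\<lambda>\<omega>. exp (Y \<omega>))"
    and "(\<integral>\<omega>. exp (Y \<omega>) \<partial>M) = 1"
  shows "measure M {\<omega> \<in> space M. (MAX t\<in>{0..n}. cusum Ys t \<omega>) \<ge> h}
           \<le> min (exp (- h) * (1 + real n * (\<integral>\<omega>. max (1 - exp (Y \<omega>)) 0 \<partial>M))) 1
         \<and> integrable M (\<lambda>\<omega>. exp (cusum Ys n \<omega>))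
         \<and> (\<integral>\<omega>. exp (cusum Ys n \<omega>) \<partial>M)
           \<le> 1 + real n * (\<integral>\<omega>. max (1 - exp (Y \<omega>)) 0 \<partial>M)"
proof -
  interpret prob_space M by fact
  let ?B = "1 + real n * (\<integral>\<omega>. max (1 - exp (Y \<omega>)) 0 \<partial>M)"
  let ?V = "stopped_cusum {h..} Ys n"
  note moment = stopped_cusum_exp_moment[OF assms(2-6), of _ n]
  have int: "integrable M (\<lambda>\<omega>. exp (?V \<omega>))" and le: "expectation (\<lambda>\<omega>. exp (?V \<omega>)) \<le> ?B"
    using moment[of "{h..}"] by auto
  \<comment> \<open>The equivalence is pointwise and covers \<open>h \<le> 0\<close> too, where the
    process freezes at time 0.\<close>
  have "(MAX t\<in>{0..n}. cusum Ys t \<omega>) \<ge> h \<longleftrightarrow> exp (?V \<omega>) \<ge> exp h" for \<omega>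
  proof -
    have "(MAX t\<in>{0..n}. cusum Ys t \<omega>) \<ge> h \<longleftrightarrow> (\<exists>t\<le>n. cusum Ys t \<omega> \<in> {h..})"
      by (subst Max_ge_iff) auto
    then show ?thesis
      using stopped_cusum_hits_iff[of "{h..}" Ys n \<omega>] by simp
  qed
  then have "prob {\<omega> \<in> space M. (MAX t\<in>{0..n}. cusum Ys t \<omega>) \<ge> h}
      = prob {\<omega> \<in> space M. exp (?V \<omega>) \<ge> exp h}"
    by simp
  also have "\<dots> \<le> expectation (\<lambda>\<omega>. exp (?V \<omega>)) / exp h"
    by (rule integral_Markov_inequality_measure[OF int]) auto
  also have "\<dots> \<le> exp (- h) * ?B"
    using le by (simp add: exp_minus field_simps)
  \<comment> \<open>The bound by 1 holds for any probability; the moment claim is the case of the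
    empty set.\<close>
  finally show ?thesis
    using moment[of "{}"] by (simp add: stopped_cusum_empty)
qed

end
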